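(* For any $\boldsymbol{\eta}=(\eta_k)_{k\in\mathbb{N}}\in(0,\infty)^{\mathbb{N}}$ and any $n\in\mathbb{N}$, $$N_n(t)\le \log Q_n(\boldsymbol{\eta})+2\log(6n)+\frac{8n}{\sqrt{t}-2}\qquad\text{for all } t>8.$$
   Context: $\mathbb{N}=\{1,2,3,\ldots\}$ and $[n]=\{1,\ldots,n\}$; $\log$ is the natural logarithm. For $\boldsymbol{\eta}=(\eta_k)_{k\in\mathbb{N}}\in(0,\infty)^{\mathbb{N}}$ and $n\in\mathbb{N}$, define $$Q_n(\boldsymbol{\eta})=\max_{\lambda\in[0,1]}\lambda\prod_{k=1}^n(1-\eta_k\lambda)^2,$$ and, for $t\ge 0$, let $N_n(t)=|\{k\in[n]:\eta_k>t\}|$ be the number of the first $n$ stepsizes that are larger than $t$. *)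

theory Defs
  imports "HOL-Analysis.Analysis"
begin

(* Stepsize sequences are indexed by the positive integers; the value at index 0 of a function
   on nat plays no role in the definitions below. *)

definition rate_fun :: "(nat \<Rightarrow> real) \<Rightarrow> nat \<Rightarrow> real \<Rightarrow> real"
  where "rate_fun \<eta> n x = x * (\<Prod>k=1..n. (1 - \<eta> k * x)\<^sup>2)"

(* Max is only meaningful on finite sets, so the maximum over [0,1] is written as a supremum;
   Q_attained and Q_upper show that it is the maximum. *)
definition Q :: "nat \<Rightarrow> (nat \<Rightarrow> real) \<Rightarrow> real"
  where "Q n \<eta> = (SUP x\<in>{0..1}. rate_fun \<eta> n x)"

definition N :: "(nat \<Rightarrow> real) \<Rightarrow> nat \<Rightarrow> real \<Rightarrow> nat"
  where "N \<eta> n t = card {k \<in> {1..n}. \<eta> k > t}"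

lemma rate_fun_has_max:
  "\<exists>x\<in>{0..1}. \<forall>y\<in>{0..1}. rate_fun \<eta> n y \<le> rate_fun \<eta> n x"
proof -
  have "continuous_on {0..1::real} (rate_fun \<eta> n)"
    unfolding rate_fun_def[abs_def] by (intro continuous_intros)
  then show ?thesis
    using continuous_attains_sup[of "{0..1::real}" "rate_fun \<eta> n"] by simp
qed

lemma Q_upper:
  assumes "x \<in> {0..1}"
  shows "rate_fun \<eta> n x \<le> Q n \<eta>"
  unfolding Q_def
  by (rule cSUP_upper[OF assms]) (meson rate_fun_has_max bdd_aboveI2)

lemma Q_attained: "\<exists>x\<in>{0..1}. Q n \<eta> = rate_fun \<eta> n x"
proof -
  obtain x where x: "x \<in> {0..1}" "\<forall>y\<in>{0..1}. rate_fun \<eta> n y \<le> rate_fun \<eta> n x"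
    using rate_fun_has_max by blast
  have "Q n \<eta> \<le> rate_fun \<eta> n x"
    unfolding Q_def using x by (intro cSUP_least) auto
  with Q_upper[OF x(1)] x(1) show ?thesis
    by (metis order_antisym)
qed

end

theory Submission
  imports Defs "HOL-Complex_Analysis.Conformal_Mappings"
begin

text \<open>
  Put a = 4/t. The stepsizes above t contribute factors at least 3 in absolute value on all of [a, 1],
  so it suffices to find a point of [a, 1] where the product over the other stepsizes is not small.
  Such a point is supplied by a Bernstein--Walsh argument: a polynomial of degree m with value 1
  at 0 reaches ((1 - sqrt a) / (1 + sqrt a))^m in absolute value somewhere on [a, 1].
  The loss ln (t/4) coming from the factor x in the rate is harmless after replacing t by
  min t (100 n^2), provided some stepsize exceeds t; if none does, a = 1/(4 n^2) gives
  Q >= 1/(6 n)^2 directly.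
\<close>

lemma one_minus_over_one_plus_bounds:
  fixes s :: real
  assumes "0 \<le> s" "s < 1"
  shows "0 < (1 - s) / (1 + s)" "(1 - s) / (1 + s) \<le> 1"
  using assms by auto

text \<open>
  The map J w = (1 + a)/2 + (1 - a)/4 * (w + 1/w) sends the unit circle onto [a, 1] and the
  point - (1 - sqrt a)/(1 + sqrt a) to 0. Each factor F k w below is w * (1 - c k * J w), with the
  pole of J at 0 cancelled, so the maximum modulus principle applies to the product.
\<close>

lemma exists_large_product:
  fixes c :: "'b \<Rightarrow> real"
  assumes "0 \<le> a" "a < 1"
  shows "\<exists>x\<in>{a..1}. ((1 - sqrt a) / (1 + sqrt a)) ^ card A \<le> (\<Prod>k\<in>A. \<bar>1 - c k * x\<bar>)"
proof -
  define r where "r = (1 - sqrt a) / (1 + sqrt a)"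
  define F :: "'b \<Rightarrow> complex \<Rightarrow> complex" where
    "F k w = w - of_real (c k) * (of_real ((1 + a) / 2) * w + of_real ((1 - a) / 4) * (w\<^sup>2 + 1))"
    for k w
  define P where "P w = (\<Prod>k\<in>A. F k w)" for w
  have s: "0 \<le> sqrt a" "sqrt a < 1" "(sqrt a)\<^sup>2 = a"
    using assms by auto
  then have r: "0 < r" "r \<le> 1"
    unfolding r_def by (intro one_minus_over_one_plus_bounds; simp)+
  \<comment> \<open>This is \<open>w * J w = 0\<close> at \<open>w = - r\<close>. There every factor
    \<open>F k w\<close> reduces to \<open>w\<close>, so \<open>P\<close> has modulus
    \<open>r ^ card A\<close> whatever the \<open>c k\<close> are.\<close>
  have root: "(1 + a) / 2 * (- r) + (1 - a) / 4 * (r\<^sup>2 + 1) = 0"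
  proof -
    define s where "s = sqrt a"
    have a: "a = s\<^sup>2" using s by (simp add: s_def)
    have e: "(1 + s) * r = 1 - s"
    proof -
      have "1 + s > 0" using s(1) unfolding s_def by linarith
      then show ?thesis unfolding r_def s_def [symmetric] by simp
    qed
    have "(1 - a) * (r\<^sup>2 + 1) = (1 + s) * (1 - s) * (r\<^sup>2 + 1)"
      by (simp add: a power2_eq_square algebra_simps)
    also have "\<dots> = r * (((1 + s) * r)\<^sup>2 + (1 + s)\<^sup>2)"
      by (simp add: e [symmetric] power2_eq_square algebra_simps)
    also have "\<dots> = 2 * (1 + a) * r"
      unfolding e by (simp add: a power2_eq_square algebra_simps)
    finally show ?thesis by simp
  qed
  have "F k (of_real (- r)) = of_real (- r)" for k
  proof -
    have "F k (of_real (- r)) =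
        of_real (- r - c k * ((1 + a) / 2 * (- r) + (1 - a) / 4 * (r\<^sup>2 + 1)))"
      by (simp add: F_def)
    with root show ?thesis by simp
  qed
  then have P0: "norm (P (of_real (- r))) = r ^ card A"
    using r by (simp add: P_def norm_power)
  have hol: "P holomorphic_on UNIV"
    unfolding P_def [abs_def] F_def by (intro holomorphic_intros)
  have "\<exists>w. norm w = 1 \<and> r ^ card A \<le> norm (P w)"
  proof (rule ccontr)
    assume no: "\<not> ?thesis"
    \<comment> \<open>Maximum modulus only bounds \<open>P\<close> by a non-strict inequality.
      Attaining the maximum over the circle at some \<open>v\<close> turns the assumed strict
      inequalities into a contradiction.\<close>
    have cont: "continuous_on (sphere 0 1) (\<lambda>w. norm (P w))"
      by (intro continuous_intros holomorphic_on_imp_continuous_on holomorphic_on_subset [OF hol]) auto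
    obtain v where v: "norm v = 1" "\<And>w. norm w = 1 \<Longrightarrow> norm (P w) \<le> norm (P v)"
      using continuous_attains_sup [OF compact_sphere _ cont] by auto
    have "norm (P (of_real (- r))) \<le> norm (P v)"
    proof (rule maximum_modulus_frontier [of P "cball 0 1"])
      show "P holomorphic_on interior (cball 0 1)"
        using hol holomorphic_on_subset by blast
      show "continuous_on (closure (cball 0 1)) P"
        using hol holomorphic_on_imp_continuous_on holomorphic_on_subset by blast
    qed (use v r in auto)
    with P0 v(1) no show False by auto
  qed
  then obtain w where w: "norm w = 1" "r ^ card A \<le> norm (P w)" by blast
  \<comment> \<open>On the unit circle \<open>1 / w = cnj w\<close>, so this real number is
    \<open>J w\<close>.\<close>
  define x where "x = (1 + a) / 2 + (1 - a) / 2 * Re w"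
  have "norm (F k w) = \<bar>1 - c k * x\<bar>" for k
  proof -
    have "w * cnj w = 1"
      using w(1) by (simp add: complex_norm_square [symmetric])
    moreover have "complex_of_real (2 * Re w) = w + cnj w"
      by (simp add: complex_add_cnj)
    ultimately have "w\<^sup>2 + 1 = w * of_real (2 * Re w)"
      by (simp add: power2_eq_square algebra_simps)
    moreover have "w - of_real (c k) * (of_real p * w + of_real q * (w * of_real (2 * y))) =
        w * of_real (1 - c k * (p + q * (2 * y)))" for p q y
      by (simp add: algebra_simps)
    moreover have "x = (1 + a) / 2 + (1 - a) / 4 * (2 * Re w)"
      by (simp add: x_def)
    ultimately have "F k w = w * of_real (1 - c k * x)"
      by (simp only: F_def)
    with w(1) show ?thesis by (simp only: norm_mult norm_of_real mult_1)
  qed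
  then have "norm (P w) = (\<Prod>k\<in>A. \<bar>1 - c k * x\<bar>)"
    by (simp add: P_def prod_norm [symmetric])
  moreover have "x \<in> {a..1}"
  proof -
    have "\<bar>(1 - a) / 2 * Re w\<bar> \<le> (1 - a) / 2 * 1"
      unfolding abs_mult using abs_Re_le_cmod [of w] w(1) assms by (intro mult_mono) auto
    then show ?thesis by (auto simp: x_def abs_le_iff field_simps)
  qed
  ultimately show ?thesis
    using w(2) unfolding r_def by auto
qed

text \<open>The rate is evaluated at a point \<open>x\<close> of [a, 1] where the product over the
  stepsizes at most \<open>4 / a\<close> is at least \<open>r ^ n\<close>. Each remaining stepsize
  has \<open>\<eta> k * x \<ge> 4\<close>, so its squared factor is at least 9; the leading factor
  \<open>x\<close> is at least \<open>a\<close>.\<close>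

lemma Q_lower_bound:
  assumes "0 < a" "a < 1"
  shows "a * 9 ^ N \<eta> n (4 / a) * ((1 - sqrt a) / (1 + sqrt a)) ^ (2 * n) \<le> Q n \<eta>"
proof -
  define r where "r = (1 - sqrt a) / (1 + sqrt a)"
  define L where "L = {k \<in> {1..n}. \<eta> k > 4 / a}"
  define S where "S = {1..n} - L"
  have "0 \<le> sqrt a" "sqrt a < 1"
    using assms by auto
  then have r: "0 \<le> r" "r \<le> 1"
    using one_minus_over_one_plus_bounds [of "sqrt a"] unfolding r_def by linarith+
  obtain x where x: "a \<le> x" "x \<le> 1" and S: "r ^ card S \<le> (\<Prod>k\<in>S. \<bar>1 - \<eta> k * x\<bar>)"
    using exists_large_product [of a S \<eta>] assms unfolding r_def by auto
  have "card S \<le> n"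
    unfolding S_def by (metis Diff_subset card_atLeastAtMost card_mono diff_Suc_1 finite_atLeastAtMost)
  with r have "r ^ n \<le> r ^ card S" by (intro power_decreasing)
  with S have S': "r ^ n \<le> (\<Prod>k\<in>S. \<bar>1 - \<eta> k * x\<bar>)" by linarith
  have L: "3 ^ N \<eta> n (4 / a) \<le> (\<Prod>k\<in>L. \<bar>1 - \<eta> k * x\<bar>)"
  proof -
    have "3 \<le> \<bar>1 - \<eta> k * x\<bar>" if "k \<in> L" for k
    proof -
      have "4 / a * a \<le> \<eta> k * x"
        using that x assms by (intro mult_mono) (auto simp: L_def less_imp_le intro: order.trans [of 0 "4 / a"])
      then show ?thesis using assms by simp
    qed
    then have "(\<Prod>k\<in>L. 3) \<le> (\<Prod>k\<in>L. \<bar>1 - \<eta> k * x\<bar>)"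
      by (intro prod_mono) auto
    then show ?thesis by (simp add: N_def L_def)
  qed
  have "{1..n} = S \<union> L" "S \<inter> L = {}" "finite S" "finite L"
    by (auto simp: S_def L_def)
  then have split: "(\<Prod>k=1..n. \<bar>1 - \<eta> k * x\<bar>) = (\<Prod>k\<in>S. \<bar>1 - \<eta> k * x\<bar>) * (\<Prod>k\<in>L. \<bar>1 - \<eta> k * x\<bar>)"
    by (simp add: prod.union_disjoint)
  have "r ^ n * 3 ^ N \<eta> n (4 / a) \<le> (\<Prod>k=1..n. \<bar>1 - \<eta> k * x\<bar>)"
    unfolding split using S' L r by (intro mult_mono) (auto intro: prod_nonneg)
  then have "(r ^ n * 3 ^ N \<eta> n (4 / a))\<^sup>2 \<le> (\<Prod>k=1..n. \<bar>1 - \<eta> k * x\<bar>)\<^sup>2"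
    using r by (intro power_mono) auto
  then have "a * (r ^ n * 3 ^ N \<eta> n (4 / a))\<^sup>2 \<le> x * (\<Prod>k=1..n. \<bar>1 - \<eta> k * x\<bar>)\<^sup>2"
    using x assms by (intro mult_mono) auto
  also have "\<dots> = rate_fun \<eta> n x"
    by (simp only: rate_fun_def prod_power_distrib power2_abs)
  also have "\<dots> \<le> Q n \<eta>"
    using x assms by (intro Q_upper) auto
  also have "(r ^ n * 3 ^ N \<eta> n (4 / a))\<^sup>2 = 9 ^ N \<eta> n (4 / a) * r ^ (2 * n)"
  proof -
    have "((3::real) ^ m)\<^sup>2 = 9 ^ m" for m
      by (simp add: power2_eq_square flip: power_mult_distrib)
    then show ?thesis
      by (simp add: power_mult_distrib power_even_eq)
  qed
  finally show ?thesis by (simp add: r_def mult.assoc)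
qed

text \<open>The left side is \<open>1 / r ^ n\<close> for \<open>sqrt a = 1 / (2 * n)\<close>. It
  tends to e and equals 3 at \<open>n = 1\<close>.\<close>

lemma power_ratio_le_3:
  fixes n :: nat
  assumes "n \<ge> 1"
  shows "((2 * real n + 1) / (2 * real n - 1)) ^ n \<le> 3"
proof (cases "n \<ge> 6")
  case True
  define d where "d = 2 / (2 * real n - 1)"
  have "(2 * real n + 1) / (2 * real n - 1) = 1 + d"
    using assms by (simp add: d_def field_simps)
  also have "\<dots> \<le> exp d" by (rule exp_ge_add_one_self)
  finally have "((2 * real n + 1) / (2 * real n - 1)) ^ n \<le> exp d ^ n"
    using assms by (intro power_mono) auto
  also have "\<dots> = exp (real n * d)" by (simp add: exp_of_nat_mult)
  \<comment> \<open>The exponent is \<open>2 * n / (2 * n - 1)\<close>, which is 12/11 at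
    \<open>n = 6\<close>. At \<open>n = 5\<close> it would be 10/9, already larger than
    \<open>ln 3\<close>, hence the separate check of small \<open>n\<close>.\<close>
  also have "\<dots> \<le> exp (12 / 11)"
    using True by (simp add: d_def field_simps)
  also have "\<dots> \<le> 3"
  \<comment> \<open>Eleventh powers reduce the claim to \<open>e ^ 12 \<le> 3 ^ 11\<close>, for
    which e < 2.72 suffices.\<close>
  proof (rule power_le_imp_le_base [of _ 10])
    have "exp (12 / 11) ^ Suc 10 = exp (1::real) ^ 12"
      by (simp flip: exp_of_nat_mult)
    also have "\<dots> \<le> (272 / 100) ^ 12"
      using e_less_272 by (intro power_mono) auto
    also have "\<dots> \<le> 3 ^ Suc 10" by (simp add: power_divide)
    finally show "exp (12 / 11) ^ Suc 10 \<le> (3::real) ^ Suc 10" .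
  qed simp
  finally show ?thesis .
next
  case False
  with assms have "n \<in> {1, 2, 3, 4, 5}" by auto
  then show ?thesis by (auto simp: power_divide)
qed

text \<open>With \<open>a = 1 / (4 * n\<^sup>2)\<close> the power \<open>r ^ (2 * n)\<close> is at
  least 1/9, and the powers of 9 are bounded below by 1.\<close>

lemma Q_ge:
  fixes n :: nat
  assumes "n \<ge> 1"
  shows "1 / (6 * real n)\<^sup>2 \<le> Q n \<eta>"
proof -
  define a where "a = (1 / (2 * real n))\<^sup>2"
  define r where "r = (1 - sqrt a) / (1 + sqrt a)"
  have sa: "sqrt a = 1 / (2 * real n)" by (simp add: a_def)
  have a: "0 < a" "a < 1"
    using assms sa real_sqrt_gt_0_iff [of a] real_sqrt_lt_1_iff [of a] by auto
  have rr: "r = 1 / ((2 * real n + 1) / (2 * real n - 1))"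
  proof -
    define m where "m = 2 * real n"
    have "m \<ge> 2" using assms by (simp add: m_def)
    then show ?thesis
      unfolding r_def sa m_def [symmetric] by (simp add: divide_simps)
  qed
  have "1 / 3 \<le> 1 / ((2 * real n + 1) / (2 * real n - 1)) ^ n"
    using assms by (intro divide_left_mono power_ratio_le_3) auto
  then have "1 / 3 \<le> r ^ n" by (simp only: rr power_one_over)
  then have "(1 / 3)\<^sup>2 \<le> (r ^ n)\<^sup>2" by (intro power_mono) auto
  then have "1 * (1 / 3)\<^sup>2 \<le> 9 ^ N \<eta> n (4 / a) * r ^ (2 * n)"
    by (intro mult_mono) (auto simp: power_even_eq)
  then have "a * (1 * (1 / 3)\<^sup>2) \<le> a * (9 ^ N \<eta> n (4 / a) * r ^ (2 * n))"
    using a by (intro mult_left_mono) auto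
  also have "\<dots> \<le> Q n \<eta>"
    using Q_lower_bound [OF a, of \<eta> n] by (simp add: r_def mult.assoc)
  finally show ?thesis
    by (simp add: a_def power2_eq_square)
qed

text \<open>Logarithms are taken in \<open>Q_lower_bound\<close> at \<open>a = 4 / t\<close>. Since
  \<open>ln (1 / r) \<le> 1 / r - 1 = 4 / (sqrt t - 2)\<close>, the power \<open>r ^ (2 * n)\<close>
  costs at most the last term.\<close>

lemma N_ln3_le:
  assumes "t > 4"
  shows "2 * ln 3 * real (N \<eta> n t) \<le> ln (Q n \<eta>) + ln (t / 4) + 8 * real n / (sqrt t - 2)"
proof -
  define a where "a = 4 / t"
  define r where "r = (1 - sqrt a) / (1 + sqrt a)"
  have a: "0 < a" "a < 1" "4 / a = t"
    using assms by (auto simp: a_def)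
  have s: "2 < sqrt t" using assms by (simp add: real_less_rsqrt)
  have sa: "sqrt a = 2 / sqrt t" by (simp add: a_def real_sqrt_divide)
  have r: "r > 0"
    using a one_minus_over_one_plus_bounds [of "sqrt a"] by (simp add: r_def)
  have "1 / r = 1 + 4 / (sqrt t - 2)"
  proof -
    define q where "q = sqrt t"
    have "q > 2" using s by (simp add: q_def)
    then show ?thesis
      unfolding r_def sa q_def [symmetric] by (simp add: divide_simps)
  qed
  moreover have "ln (1 / r) \<le> 1 / r - 1"
    using r by (intro ln_le_minus_one) auto
  ultimately have lr: "- ln r \<le> 4 / (sqrt t - 2)"
    using ln_div [of 1 r] r by simp
  have "ln (a * 9 ^ N \<eta> n t * r ^ (2 * n)) \<le> ln (Q n \<eta>)"
    using Q_lower_bound [OF a(1,2), of \<eta> n] a(3) r a(1)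
    by (intro ln_mono) (auto simp: r_def)
  moreover have "ln (a * 9 ^ N \<eta> n t * r ^ (2 * n)) = ln a + N \<eta> n t * ln 9 + 2 * n * ln r"
    using a r by (simp add: ln_mult ln_realpow)
  moreover have "ln (9::real) = 2 * ln 3"
    using ln_realpow [of 3 2] by simp
  moreover have "ln a = - ln (t / 4)"
    using assms by (simp add: a_def ln_div)
  moreover have "2 * n * (- ln r) \<le> 2 * n * (4 / (sqrt t - 2))"
    using lr by (intro mult_left_mono) auto
  ultimately show ?thesis by (simp add: algebra_simps)
qed

theorem lemma2p2:
  fixes \<eta> :: "nat \<Rightarrow> real" and n :: nat
  assumes "\<And>k. k \<ge> 1 \<Longrightarrow> \<eta> k > 0"
    and "n \<ge> 1"
  shows "\<forall>t::real. t > 8 \<longrightarrow>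
    real (N \<eta> n t) \<le> ln (Q n \<eta>) + 2 * ln (6 * real n) + 8 * real n / (sqrt t - 2)"
proof (intro allI impI)
  fix t :: real
  assume t: "t > 8"
  have s: "2 < sqrt t" using t by (simp add: real_less_rsqrt)
  show "real (N \<eta> n t) \<le> ln (Q n \<eta>) + 2 * ln (6 * real n) + 8 * real n / (sqrt t - 2)"
  proof (cases "N \<eta> n t = 0")
    case True
    \<comment> \<open>With no stepsize above \<open>t\<close>, it is enough that
      \<open>ln (Q n \<eta>) + 2 * ln (6 * n)\<close> is nonnegative.\<close>
    have "ln (1 / (6 * real n)\<^sup>2) \<le> ln (Q n \<eta>)"
      using Q_ge [OF assms(2)] assms(2) by (intro ln_mono) auto
    moreover have "ln (1 / (6 * real n)\<^sup>2) = - (2 * ln (6 * real n))"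
      using assms(2) ln_realpow [of "6 * real n" 2] by (simp only: ln_div) simp
    moreover have "0 \<le> 8 * real n / (sqrt t - 2)" using s by simp
    ultimately show ?thesis using True by simp
  next
    case False
    \<comment> \<open>The cap makes \<open>u / 4\<close> at most \<open>25 * n\<^sup>2\<close>,
      below \<open>(6 * n)\<^sup>2\<close>, and it can only increase the count.\<close>
    define u where "u = min t ((10 * real n)\<^sup>2)"
    have "1\<^sup>2 \<le> (real n)\<^sup>2" using assms(2) by (intro power_mono) auto
    then have u: "u > 4"
      using t unfolding u_def power_mult_distrib by simp
    have NN: "N \<eta> n t \<le> N \<eta> n u"
      unfolding N_def by (intro card_mono) (auto simp: u_def)
    have "ln 3 \<ge> (1::real)"
      using exp_le by (simp add: ln_ge_iff)
    then have "2 * 1 * real (N \<eta> n u) \<le> 2 * ln 3 * real (N \<eta> n u)"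
      by (intro mult_right_mono mult_left_mono) auto
    \<comment> \<open>As the count is at least 1, the coefficient \<open>2 * ln 3 \<ge> 2\<close>
      leaves a spare 1, which pays for replacing \<open>t\<close> by \<open>u\<close> in the last
      term.\<close>
    with NN False have "real (N \<eta> n t) + 1 \<le> 2 * ln 3 * real (N \<eta> n u)" by linarith
    also note N_ln3_le [OF u]
    finally have 1: "real (N \<eta> n t) + 1 \<le> ln (Q n \<eta>) + ln (u / 4) + 8 * real n / (sqrt u - 2)" .
    have "ln (u / 4) \<le> ln ((6 * real n)\<^sup>2)"
      using u by (intro ln_mono) (use assms(2) in \<open>auto simp: u_def power_mult_distrib\<close>)
    then have 2: "ln (u / 4) \<le> 2 * ln (6 * real n)"
      using ln_realpow [of "6 * real n" 2] assms(2) by simp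
    have "8 * real n / (sqrt u - 2) \<le> 1 + 8 * real n / (sqrt t - 2)"
    proof (cases "t \<le> (10 * real n)\<^sup>2")
      case True
      then show ?thesis by (simp add: u_def)
    next
      case False
      then have "u = (10 * real n)\<^sup>2" by (simp add: u_def)
      then have "sqrt u = 10 * real n" by (simp only: real_sqrt_abs abs_mult abs_of_nat abs_numeral)
      \<comment> \<open>Here \<open>10 * n - 2 \<ge> 8 * n\<close>, which is why the cap has the
        constant 10.\<close>
      then have "8 * real n / (sqrt u - 2) \<le> 1" using assms(2) by simp
      moreover have "0 \<le> 8 * real n / (sqrt t - 2)" using s by simp
      ultimately show ?thesis by linarith
    qed
    with 1 2 show ?thesis by linarith
  qed
qed

end
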